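(* Let $X$ be a Banach space, $E\subset X$ a nonempty closed convex subset, and $k\geq 2$ a fixed integer. Let $T:E\to E$ be a contractive-like operator, i.e. there are a constant $\delta\in[0,1)$ and a strictly increasing continuous function $\varphi:[0,\infty)\to[0,\infty)$ with $\varphi(0)=0$ such that $\|Tx-Ty\|\leq\delta\|x-y\|+\varphi(\|x-Tx\|)$ for all $x,y\in E$. Assume that the set $F_T$ of fixed points of $T$ is nonempty. Let $\varepsilon>0$ and let $\widetilde{T}:E\to E$ be an approximate operator of $T$, i.e. $\|Tx-\widetilde{T}x\|\leq\varepsilon$ for all $x\in E$. Let $\{\alpha_n\}_{n=0}^\infty$ and $\{\beta_n^i\}_{n=0}^\infty$, $i=1,\dots,k-1$, be real sequences in $[0,1)$ satisfying (i) $0\leq\beta_n^i<\alpha_n\leq 1$ for all $n\in\mathbb{N}$ and $i=1,\dots,k-1$, and (ii) $\sum_{n=0}^\infty\alpha_n=\infty$. Let $\{x_n\}_{n=0}^\infty$ and $\{u_n\}_{n=0}^\infty$ be the new multistep iterations of order $k$ associated to $T$ (starting from $x_0\in E$) and to $\widetilde{T}$ (starting from $u_0\in E$), respectively, both with these parameter sequences. If $p=Tp$ and $q=\widetilde{T}q$, then $$\|p-q\|\leq\frac{k\varepsilon}{1-\delta}.$$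
   Context: $\mathbb{N}$ denotes the set of nonnegative integers. For a self-map $S:E\to E$ and an integer $k\geq2$, the new multistep iteration of order $k$ associated to $S$, with parameters $\{\alpha_n\}$ and $\{\beta_n^i\}$ ($i=1,\dots,k-1$), starting from $x_0\in E$, is the sequence $\{x_n\}$ given for $n\in\mathbb{N}$ by $$x_{n+1}=(1-\alpha_n)y_n^1+\alpha_n Sy_n^1,$$ $$y_n^i=(1-\beta_n^i)y_n^{i+1}+\beta_n^i Sy_n^{i+1},\quad i=1,\dots,k-2,$$ $$y_n^{k-1}=(1-\beta_n^{k-1})x_n+\beta_n^{k-1}Sx_n.$$ (For $k=2$ the middle line is empty.) *)

theory Defs
  imports "HOL-Analysis.Analysis"
begin

text \<open>Operators \<open>E \<rightarrow> E\<close> are functions on the whole space, constrained only on \<open>E\<close>; invariance of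
  \<open>E\<close> is assumed separately where the notions below are used.\<close>

definition contractive_like_on ::
  "'a::real_normed_vector set \<Rightarrow> real \<Rightarrow> (real \<Rightarrow> real) \<Rightarrow> ('a \<Rightarrow> 'a) \<Rightarrow> bool" where
  "contractive_like_on E \<delta> \<phi> T \<longleftrightarrow>
     \<delta> \<in> {0..<1} \<and>
     \<phi> \<in> {0..} \<rightarrow> {0..} \<and> strict_mono_on {0..} \<phi> \<and> continuous_on {0..} \<phi> \<and> \<phi> 0 = 0 \<and>
     (\<forall>x\<in>E. \<forall>y\<in>E. norm (T x - T y) \<le> \<delta> * norm (x - y) + \<phi> (norm (x - T x)))"

definition approximate_operator_on ::
  "'a::real_normed_vector set \<Rightarrow> real \<Rightarrow> ('a \<Rightarrow> 'a) \<Rightarrow> ('a \<Rightarrow> 'a) \<Rightarrow> bool" where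
  "approximate_operator_on E \<epsilon> T T' \<longleftrightarrow> (\<forall>x\<in>E. norm (T x - T' x) \<le> \<epsilon>)"

definition fixed_points_on :: "'a set \<Rightarrow> ('a \<Rightarrow> 'a) \<Rightarrow> 'a set" where
  "fixed_points_on E T = {x \<in> E. T x = x}"

text \<open>\<open>\<beta> n i\<close> and \<open>y n i\<close> carry the step \<open>n\<close> first and the upper index \<open>i \<in> {1..k - 1}\<close> second.
  The relation is meant for \<open>k \<ge> 2\<close>, where it determines \<open>x\<close> uniquely
  (lemma \<open>new_multistep_ex1\<close>).\<close>

definition new_multistep ::
  "nat \<Rightarrow> ('a::real_vector \<Rightarrow> 'a) \<Rightarrow> (nat \<Rightarrow> real) \<Rightarrow> (nat \<Rightarrow> nat \<Rightarrow> real) \<Rightarrow> 'a \<Rightarrow> (nat \<Rightarrow> 'a) \<Rightarrow> bool" where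
  "new_multistep k S \<alpha> \<beta> x0 x \<longleftrightarrow>
     x 0 = x0 \<and>
     (\<exists>y :: nat \<Rightarrow> nat \<Rightarrow> 'a. \<forall>n.
        x (n + 1) = (1 - \<alpha> n) *\<^sub>R y n 1 + \<alpha> n *\<^sub>R S (y n 1) \<and>
        (\<forall>i\<in>{1..k - 2}. y n i = (1 - \<beta> n i) *\<^sub>R y n (i + 1) + \<beta> n i *\<^sub>R S (y n (i + 1))) \<and>
        y n (k - 1) = (1 - \<beta> n (k - 1)) *\<^sub>R x n + \<beta> n (k - 1) *\<^sub>R S (x n))"

lemma new_multistep_ex1:
  fixes S :: "'a::real_vector \<Rightarrow> 'a"
  assumes k: "k \<ge> 2"
  shows "\<exists>!x. new_multistep k S \<alpha> \<beta> x0 x"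
proof -
  define step where "step = (\<lambda>t v. (1 - t) *\<^sub>R v + t *\<^sub>R S v)"
  define z where "z = (\<lambda>n v. rec_nat v (\<lambda>j w. step (\<beta> n (k - 1 - j)) w))"
  have z0: "z n v 0 = v" for n v by (simp add: z_def)
  have zS: "z n v (Suc j) = step (\<beta> n (k - 1 - j)) (z n v j)" for n v j by (simp add: z_def)
  define X where "X = rec_nat x0 (\<lambda>n v. step (\<alpha> n) (z n v (k - 1)))"
  have X0: "X 0 = x0" by (simp add: X_def)
  have XS: "X (Suc n) = step (\<alpha> n) (z n (X n) (k - 1))" for n by (simp add: X_def)
  have nm: "new_multistep k S \<alpha> \<beta> x0 x \<longleftrightarrow> x 0 = x0 \<and> (\<exists>y. \<forall>n.
        x (Suc n) = step (\<alpha> n) (y n 1) \<and>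
        (\<forall>i\<in>{1..k - 2}. y n i = step (\<beta> n i) (y n (Suc i))) \<and>
        y n (k - 1) = step (\<beta> n (k - 1)) (x n))" for x
    unfolding new_multistep_def step_def by simp
  show ?thesis
  proof (rule ex1I)
    have "\<forall>n. X (Suc n) = step (\<alpha> n) (z n (X n) (k - 1)) \<and>
        (\<forall>i\<in>{1..k - 2}. z n (X n) (k - i) = step (\<beta> n i) (z n (X n) (k - Suc i))) \<and>
        z n (X n) (k - (k - 1)) = step (\<beta> n (k - 1)) (X n)"
    proof (intro allI conjI ballI)
      fix n i assume i: "i \<in> {1..k - 2}"
      have eqs: "k - i = Suc (k - Suc i)" "k - 1 - (k - Suc i) = i" using i k by auto
      have "z n (X n) (Suc (k - Suc i)) = step (\<beta> n i) (z n (X n) (k - Suc i))"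
        by (simp only: zS eqs(2))
      then show "z n (X n) (k - i) = step (\<beta> n i) (z n (X n) (k - Suc i))"
        by (simp only: eqs(1))
    next
      fix n
      have "k - (k - 1) = Suc 0" using k by simp
      then show "z n (X n) (k - (k - 1)) = step (\<beta> n (k - 1)) (X n)"
        by (simp add: zS z0)
    qed (simp add: XS)
    then show "new_multistep k S \<alpha> \<beta> x0 X"
      unfolding nm using X0 by (intro conjI exI[of _ "\<lambda>n i. z n (X n) (k - i)"]) auto
  next
    fix x assume "new_multistep k S \<alpha> \<beta> x0 x"
    then obtain y where x0: "x 0 = x0" and y1: "\<And>n. x (Suc n) = step (\<alpha> n) (y n 1)"
      and y2: "\<And>n i. i \<in> {1..k - 2} \<Longrightarrow> y n i = step (\<beta> n i) (y n (Suc i))"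
      and y3: "\<And>n. y n (k - 1) = step (\<beta> n (k - 1)) (x n)"
      unfolding nm by blast
    have yz: "j \<le> k - 2 \<Longrightarrow> y n (k - 1 - j) = z n (x n) (Suc j)" for n j
    proof (induction j)
      case 0
      then show ?case using y3[of n] by (simp add: zS z0)
    next
      case (Suc j)
      have "k - 1 - Suc j \<in> {1..k - 2}" "Suc (k - 1 - Suc j) = k - 1 - j" using Suc.prems by auto
      then have "y n (k - 1 - Suc j) = step (\<beta> n (k - 1 - Suc j)) (y n (k - 1 - j))"
        using y2[of "k - 1 - Suc j" n] by simp
      also have "y n (k - 1 - j) = z n (x n) (Suc j)" using Suc by simp
      finally show ?case by (simp only: zS)
    qed
    have y1z: "y n 1 = z n (x n) (k - 1)" for n
    proof -
      have "k - 1 - (k - 2) = 1" "Suc (k - 2) = k - 1" using k by auto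
      then show ?thesis using yz[of "k - 2" n] by simp
    qed
    have "x n = X n" for n
      by (induction n) (use x0 X0 y1 y1z XS in auto)
    then show "x = X" by (rule ext)
  qed
qed

end

(* The contractive-like inequality at the fixed point p has vanishing phi-term, so
   norm (p - q) <= delta * norm (p - q) + epsilon. This bounds the distance by
   epsilon / (1 - delta). *)
theory Submission
  imports Defs
begin

text \<open>Compare both operators at \<open>q\<close>. Since \<open>T' q = q\<close>, the point
  \<open>T q\<close> lies within \<epsilon> of \<open>q\<close>; since \<open>p\<close> is fixed by
  \<open>T\<close>, applying \<open>T\<close> brings \<open>q\<close> closer to \<open>p\<close> by
  the factor \<delta>. Going from \<open>p\<close> to \<open>q\<close> through \<open>T q\<close>
  bounds the distance by \<delta> times itself plus \<epsilon>, and \<delta> < 1 lets the first term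
  be absorbed on the left. The factor \<open>k\<close> then only enlarges the bound.\<close>

lemma contractive_like_on_fixed_points_dist:
  fixes T T' :: "'a::real_normed_vector \<Rightarrow> 'a"
  assumes T: "contractive_like_on E \<delta> \<phi> T" and T': "approximate_operator_on E \<epsilon> T T'"
    and p: "p \<in> fixed_points_on E T" and q: "q \<in> fixed_points_on E T'"
  shows "norm (p - q) \<le> \<epsilon> / (1 - \<delta>)"
proof -
  have pE: "p \<in> E" "T p = p" and qE: "q \<in> E" "T' q = q"
    using p q by (auto simp: fixed_points_on_def)
  have \<delta>: "\<delta> < 1" and \<phi>0: "\<phi> 0 = 0"
    and "norm (T p - T q) \<le> \<delta> * norm (p - q) + \<phi> (norm (p - T p))"
    using T pE(1) qE(1) by (auto simp: contractive_like_on_def)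
  \<comment> \<open>The contractive-like inequality is asymmetric: its \<phi>-term measures the
    displacement of the first argument only. With \<open>p\<close> in that place the term is
    \<open>\<phi> 0 = 0\<close>.\<close>
  then have "norm (p - T q) \<le> \<delta> * norm (p - q)"
    by (simp add: pE)
  moreover have "norm (T q - q) \<le> \<epsilon>"
    using T' qE by (force simp: approximate_operator_on_def)
  moreover have "norm (p - q) \<le> norm (p - T q) + norm (T q - q)"
    using norm_triangle_ineq[of "p - T q" "T q - q"] by simp
  ultimately have "(1 - \<delta>) * norm (p - q) \<le> \<epsilon>"
    by (simp add: algebra_simps)
  then show ?thesis
    using \<delta> by (simp add: pos_le_divide_eq mult.commute)
qed

theorem theorem2:
  fixes E :: "'a::banach set"
    and T T' :: "'a \<Rightarrow> 'a"
    and k :: nat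
    and \<delta> \<epsilon> :: real
    and \<phi> :: "real \<Rightarrow> real"
    and \<alpha> :: "nat \<Rightarrow> real"
    and \<beta> :: "nat \<Rightarrow> nat \<Rightarrow> real"
    and x u :: "nat \<Rightarrow> 'a"
    and x0 u0 p q :: 'a
  assumes "E \<noteq> {}" and "closed E" and "convex E"
    and "k \<ge> 2"
    and "T \<in> E \<rightarrow> E"
    and "contractive_like_on E \<delta> \<phi> T"
    and "fixed_points_on E T \<noteq> {}"
    and "\<epsilon> > 0"
    and "T' \<in> E \<rightarrow> E"
    and "approximate_operator_on E \<epsilon> T T'"
    and "\<And>n. \<alpha> n \<in> {0..<1}"
    and "\<And>n i. i \<in> {1..k - 1} \<Longrightarrow> \<beta> n i \<in> {0..<1}"
    and "\<And>n i. i \<in> {1..k - 1} \<Longrightarrow> 0 \<le> \<beta> n i \<and> \<beta> n i < \<alpha> n \<and> \<alpha> n \<le> 1"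
    and "filterlim (\<lambda>N. \<Sum>n<N. \<alpha> n) at_top sequentially"
    and "x0 \<in> E" and "new_multistep k T \<alpha> \<beta> x0 x"
    and "u0 \<in> E" and "new_multistep k T' \<alpha> \<beta> u0 u"
    and "p \<in> fixed_points_on E T"
    and "q \<in> fixed_points_on E T'"
  shows "norm (p - q) \<le> real k * \<epsilon> / (1 - \<delta>)"
proof -
  have "\<delta> < 1"
    using assms(6) by (simp add: contractive_like_on_def)
  \<comment> \<open>The leading \<open>1 *\<close> gives both sides the product shape of
    \<open>mult_right_mono\<close>, leaving \<open>1 \<le> real k\<close> and
    \<open>0 \<le> \<epsilon>\<close>.\<close>
  moreover have "1 * \<epsilon> \<le> real k * \<epsilon>"
    using assms(4,8) by (intro mult_right_mono) auto
  ultimately have "\<epsilon> / (1 - \<delta>) \<le> real k * \<epsilon> / (1 - \<delta>)"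
    by (intro divide_right_mono) auto
  with contractive_like_on_fixed_points_dist[OF assms(6,10,19,20)] show ?thesis
    by (rule order_trans)
qed

end
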